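(* Let $R$ be the class of all finitely additive probabilities $\mu$ on the power set of $\mathbb{Z}$ such that $\mu(j \bmod m)=1/m$ for every positive integer $m$ and every integer $j$, and let $PR$ be the class of all finitely additive probabilities $\mu$ on the power set of $\mathbb{Z}$ such that $\mu(j\bmod p)=1/p$ for every prime $p$ and every integer $j$. Then $R$ is a strict subset of $PR$: $R\subseteq PR$ and $R\neq PR$.
   Context: A finitely additive probability on the power set of $\mathbb{Z}$ is a function $\mu:2^{\mathbb{Z}}\to[0,\infty)$ with $\mu(\mathbb{Z})=1$ and $\mu(A\cup B)=\mu(A)+\mu(B)$ for all disjoint $A,B\subseteq\mathbb{Z}$. For integers $j$ and $m\ge 1$, $j \bmod m$ denotes the residue class $\{z\in\mathbb{Z}: z\equiv j \pmod m\}$. *)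

theory Defs
  imports "HOL-Analysis.Analysis" "HOL-Number_Theory.Cong"
begin

(* In Measure_Space, "additive M f" is finite additivity on disjoint members of M. *)
definition fin_add_prob :: "(int set \<Rightarrow> real) \<Rightarrow> bool" where
  "fin_add_prob \<mu> \<longleftrightarrow> (\<forall>A. 0 \<le> \<mu> A) \<and> \<mu> UNIV = 1 \<and> additive (Pow UNIV) \<mu>"

definition residue_class :: "int \<Rightarrow> nat \<Rightarrow> int set" where
  "residue_class j m = {z. [z = j] (mod int m)}"

definition R_probs :: "(int set \<Rightarrow> real) set" where
  "R_probs = {\<mu>. fin_add_prob \<mu> \<and>
     (\<forall>m::nat. m \<ge> 1 \<longrightarrow> (\<forall>j::int. \<mu> (residue_class j m) = 1 / real m))}"

definition PR_probs :: "(int set \<Rightarrow> real) set" where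
  "PR_probs = {\<mu>. fin_add_prob \<mu> \<and>
     (\<forall>p::nat. prime p \<longrightarrow> (\<forall>j::int. \<mu> (residue_class j p) = 1 / real p))}"

end

theory Submission
  imports Defs
begin

text \<open>
  The inclusion holds because primes are among the moduli \<open>m \<ge> 1\<close>. For strictness, start from any
  \<open>\<nu>\<close> in \<^const>\<open>R_probs\<close>, draw \<open>k\<close> according to \<open>\<nu>\<close> and toss a fair coin to output \<open>4k\<close> or
  \<open>4k + 1\<close>. Modulo an odd prime \<open>p\<close> the number \<open>4\<close> is invertible, so the output is as
  uniform as \<open>k\<close> itself; modulo \<open>2\<close> the output is the coin. Hence its law lies in \<^const>\<open>PR_probs\<close>. But it
  gives mass \<open>1/2\<close> to the multiples of \<open>4\<close>, so it is not in \<^const>\<open>R_probs\<close>.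

  It remains to see that \<^const>\<open>R_probs\<close> is nonempty (\<open>R_probs_nonempty\<close>), which needs a form of choice:
  take a cluster point, in the compact product space of all functions from sets of integers to
  the unit interval, of the uniform distributions on \<open>{0..<n!}\<close>. For \<open>n \<ge> m\<close> each residue class
  modulo \<open>m\<close> has probability exactly \<open>1/m\<close> under these distributions, and
  finite additivity, being a closed condition on finitely many coordinates, passes to cluster points
  (\<open>fin_add_prob_cluster_point\<close>).
\<close>

section \<open>Cluster points of finitely additive probabilities\<close>

lemma fin_add_prob_Un:
  assumes "fin_add_prob \<mu>" "A \<inter> B = {}"
  shows "\<mu> (A \<union> B) = \<mu> A + \<mu> B"
  using assms by (auto simp: fin_add_prob_def additive_def)

lemma fin_add_prob_le_1:
  assumes "fin_add_prob \<mu>"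
  shows "\<mu> A \<le> 1"
proof -
  have "\<mu> (A \<union> - A) = \<mu> A + \<mu> (- A)"
    using assms by (rule fin_add_prob_Un) simp
  moreover have "\<mu> (A \<union> - A) = 1" "0 \<le> \<mu> (- A)"
    using assms by (auto simp: fin_add_prob_def)
  ultimately show ?thesis by linarith
qed

lemma fin_add_prob_empty:
  assumes "fin_add_prob \<mu>"
  shows "\<mu> {} = 0"
  using fin_add_prob_Un[OF assms, of "{}" "{}"] by simp

text \<open>
  The probabilities \<open>M n\<close> lie in a product of unit intervals, which is compact by Tychonoff's theorem.
  The sequence need not have a convergent subsequence, as that product is not sequentially
  compact; instead, the limit is taken along a filter finer than the image of \<^term>\<open>sequentially\<close>
  that converges to a cluster point.
\<close>
lemma fin_add_prob_cluster_point:
  fixes M :: "nat \<Rightarrow> int set \<Rightarrow> real"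
  assumes M: "\<And>n. fin_add_prob (M n)"
  obtains \<nu> where "fin_add_prob \<nu>"
    and "\<And>A c. (\<lambda>n. M n A) \<longlonglongrightarrow> c \<Longrightarrow> \<nu> A = c"
proof -
  define K :: "(int set \<Rightarrow> real) set" where "K = (\<Pi>\<^sub>E A\<in>UNIV. {0..1})"
  define F where "F = filtermap M sequentially"
  have "compact K"
    using compactin_PiE[of "\<lambda>_. euclidean :: real topology" "UNIV :: int set set" "\<lambda>_. {0..1}"]
    by (simp add: K_def euclidean_product_topology)
  moreover have "F \<noteq> bot"
    by (simp add: F_def filtermap_bot_iff)
  moreover have "eventually (\<lambda>\<mu>. \<mu> \<in> K) F"
    using M fin_add_prob_le_1[OF M]
    by (simp add: F_def eventually_filtermap K_def PiE_UNIV_domain fin_add_prob_def)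
  ultimately obtain \<nu> where \<nu>: "inf (nhds \<nu>) F \<noteq> bot"
    unfolding compact_filter by blast
  define G where "G = inf (nhds \<nu>) F"
  have "G \<noteq> bot" using \<nu> by (simp add: G_def)
  have coord: "((\<lambda>\<mu>. \<mu> A) \<longlongrightarrow> \<nu> A) G" for A
  proof -
    have "continuous_on UNIV (\<lambda>\<mu> :: int set \<Rightarrow> real. \<mu> A)"
      by (rule continuous_on_product_coordinates)
    moreover have "((\<lambda>\<mu>. \<mu>) \<longlongrightarrow> \<nu>) G"
      by (simp add: filterlim_def filtermap_ident G_def)
    ultimately show ?thesis
      by (rule continuous_on_tendsto_compose) simp_all
  qed
  have lim: "\<nu> A = c" if "(\<lambda>n. M n A) \<longlonglongrightarrow> c" for A c
  proof -
    have "((\<lambda>\<mu>. \<mu> A) \<longlongrightarrow> c) F"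
      using that by (simp add: F_def filterlim_filtermap)
    then have "((\<lambda>\<mu>. \<mu> A) \<longlongrightarrow> c) G"
      by (rule tendsto_mono[rotated]) (simp add: G_def)
    with \<open>G \<noteq> bot\<close> coord show ?thesis by (rule tendsto_unique)
  qed
  have fap: "eventually fin_add_prob G"
    by (rule filter_leD[of G F]) (simp_all add: G_def F_def eventually_filtermap M)
  have "fin_add_prob \<nu>"
    unfolding fin_add_prob_def additive_def
  proof (intro conjI allI ballI impI)
    show "0 \<le> \<nu> A" for A
      by (rule tendsto_lowerbound[OF coord eventually_mono[OF fap] \<open>G \<noteq> bot\<close>])
        (simp add: fin_add_prob_def)
    show "\<nu> UNIV = 1"
      using M by (intro lim) (simp add: fin_add_prob_def)
    show "\<nu> (A \<union> B) = \<nu> A + \<nu> B" if "A \<inter> B = {}" for A B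
    proof (rule tendsto_unique[OF \<open>G \<noteq> bot\<close> coord])
      have "eventually (\<lambda>\<mu>. \<mu> A + \<mu> B = \<mu> (A \<union> B)) G"
        using fap by eventually_elim (simp add: fin_add_prob_Un that)
      with tendsto_add[OF coord coord] show "((\<lambda>\<mu>. \<mu> (A \<union> B)) \<longlongrightarrow> \<nu> A + \<nu> B) G"
        by (rule Lim_transform_eventually)
    qed
  qed
  with lim show ?thesis by (rule that[rotated])
qed

section \<open>A probability uniform modulo every integer\<close>

lemma fin_add_prob_uniform:
  assumes "finite S" "S \<noteq> {}"
  shows "fin_add_prob (\<lambda>A. real (card (A \<inter> S)) / real (card S))"
  using assms
  by (auto simp: fin_add_prob_def additive_def Int_Un_distrib2 add_divide_distrib[symmetric]
      simp flip: of_nat_add intro!: card_Un_disjoint)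

lemma card_residue_class_Int_block:
  assumes "m \<ge> 1"
  shows "card (residue_class j m \<inter> {0..<int (m * q)}) = q"
proof -
  define f where "f = (\<lambda>i :: int. j mod int m + int m * i)"
  have "bij_betw f {0..<int q} (residue_class j m \<inter> {0..<int (m * q)})"
  proof (rule bij_betw_byWitness[where f' = "\<lambda>z. z div int m"])
    show "\<forall>i\<in>{0..<int q}. f i div int m = i"
      using assms by (simp add: f_def)
    show "\<forall>z\<in>residue_class j m \<inter> {0..<int (m * q)}. f (z div int m) = z"
      by (auto simp: f_def residue_class_def cong_def) (metis mod_mult_div_eq)
    show "f ` {0..<int q} \<subseteq> residue_class j m \<inter> {0..<int (m * q)}"
    proof (rule image_subsetI)
      fix i assume i: "i \<in> {0..<int q}"
      have r: "0 \<le> j mod int m" "j mod int m < int m"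
        using assms by auto
      have "int m * (i + 1) \<le> int m * int q"
        using i by (intro mult_left_mono) auto
      then have "f i < int (m * q)"
        using r by (simp add: f_def algebra_simps)
      moreover have "0 \<le> f i"
        using r i by (simp add: f_def)
      ultimately show "f i \<in> residue_class j m \<inter> {0..<int (m * q)}"
        by (simp add: residue_class_def cong_def f_def)
    qed
    show "(\<lambda>z. z div int m) ` (residue_class j m \<inter> {0..<int (m * q)}) \<subseteq> {0..<int q}"
    proof (rule image_subsetI)
      fix z assume z: "z \<in> residue_class j m \<inter> {0..<int (m * q)}"
      have "int m * (z div int m) \<le> z"
        using assms minus_mod_eq_mult_div[of z "int m"] pos_mod_sign[of "int m" z] by linarith
      also have "z < int m * int q"
        using z by simp
      finally have "z div int m < int q"
        using assms by (simp add: mult_less_cancel_left_pos)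
      moreover have "0 \<le> z div int m"
        using z assms by (simp add: pos_imp_zdiv_nonneg_iff)
      ultimately show "z div int m \<in> {0..<int q}" by simp
    qed
  qed
  from bij_betw_same_card[OF this] show ?thesis by simp
qed

lemma R_probs_nonempty: "\<exists>\<nu>. \<nu> \<in> R_probs"
proof -
  define M where
    "M = (\<lambda>n A. real (card (A \<inter> {0..<int (fact n)})) / real (card {0..<int (fact n)}))"
  have "fin_add_prob (M n)" for n
    unfolding M_def by (rule fin_add_prob_uniform) auto
  then obtain \<nu> where \<nu>: "fin_add_prob \<nu>"
    and lim: "\<And>A c. (\<lambda>n. M n A) \<longlonglongrightarrow> c \<Longrightarrow> \<nu> A = c"
    using fin_add_prob_cluster_point by blast
  have "\<nu> (residue_class j m) = 1 / real m" if m: "m \<ge> 1" for j m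
  proof (rule lim, rule tendsto_eventually, rule eventually_sequentiallyI)
    fix n assume "m \<le> n"
    with m have "m dvd fact n" by (rule dvd_fact)
    then obtain q where q: "fact n = m * q" ..
    have "q \<noteq> 0"
      using q fact_nonzero[of n, where ?'a = nat] by (metis mult_0_right)
    with m show "M n (residue_class j m) = 1 / real m"
      unfolding M_def q card_residue_class_Int_block[OF m] by simp
  qed
  with \<nu> show ?thesis by (auto simp: R_probs_def)
qed

section \<open>Separating the two classes\<close>

lemma residue_class_affine_vimage:
  assumes "coprime a (int m)"
  obtains i where "(\<lambda>k. a * k + b) -` residue_class j m = residue_class i m"
proof -
  obtain x where x: "[a * x = 1] (mod int m)"
    using cong_solve_coprime_int[OF assms] by blast
  have "[a * (x * (j - b)) + b = j] (mod int m)"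
    using cong_add[OF cong_scalar_right[OF x, of "j - b"] cong_refl[of b]]
    by (simp add: mult.assoc)
  then have "[a * k + b = j] (mod int m) \<longleftrightarrow> [k = x * (j - b)] (mod int m)" for k
    using assms by (metis cong_add_rcancel cong_mult_lcancel cong_sym cong_trans)
  then show ?thesis
    by (intro that[of "x * (j - b)"]) (auto simp: residue_class_def)
qed

lemma fin_add_prob_mixture_vimage:
  assumes "fin_add_prob \<nu>"
  shows "fin_add_prob (\<lambda>A. (\<nu> (f -` A) + \<nu> (g -` A)) / 2)"
proof -
  have "\<nu> (h -` A \<union> h -` B) = \<nu> (h -` A) + \<nu> (h -` B)" if "A \<inter> B = {}" for h :: "int \<Rightarrow> int" and A B
    using that by (intro fin_add_prob_Un[OF assms]) blast
  with assms show ?thesis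
    by (simp add: fin_add_prob_def additive_def vimage_Un field_simps)
qed

theorem mainTheorem3:
  shows "R_probs \<subseteq> PR_probs \<and> R_probs \<noteq> PR_probs"
proof
  show "R_probs \<subseteq> PR_probs"
    by (auto simp: R_probs_def PR_probs_def dest: prime_ge_1_nat)
  obtain \<nu> where "\<nu> \<in> R_probs"
    using R_probs_nonempty by blast
  then have \<nu>: "fin_add_prob \<nu>"
    and unif: "\<And>m j. m \<ge> 1 \<Longrightarrow> \<nu> (residue_class j m) = 1 / real m"
    by (auto simp: R_probs_def)
  have \<nu>_triv: "\<nu> UNIV = 1" "\<nu> {} = 0"
    using \<nu> fin_add_prob_empty by (auto simp: fin_add_prob_def)
  define \<mu> where
    "\<mu> = (\<lambda>A. (\<nu> ((\<lambda>k. 4 * k + 0) -` A) + \<nu> ((\<lambda>k. 4 * k + 1) -` A)) / 2)"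
  have "\<mu> (residue_class j p) = 1 / real p" if p: "prime p" for p j
  proof (cases "p = 2")
    case True
    show ?thesis
    proof (cases "even j")
      case True
      then have "(\<lambda>k. 4 * k + 0) -` residue_class j 2 = UNIV"
        "(\<lambda>k. 4 * k + 1) -` residue_class j 2 = {}"
        by (auto simp: residue_class_def cong_def) presburger+
      with \<open>p = 2\<close> \<nu>_triv show ?thesis by (simp add: \<mu>_def)
    next
      case False
      then have "(\<lambda>k. 4 * k + 0) -` residue_class j 2 = {}"
        "(\<lambda>k. 4 * k + 1) -` residue_class j 2 = UNIV"
        by (auto simp: residue_class_def cong_def) presburger+
      with \<open>p = 2\<close> \<nu>_triv show ?thesis by (simp add: \<mu>_def)
    qed
  next
    case False
    with p have "odd p"
      using primes_dvd_imp_eq two_is_prime_nat by blast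
    then have "coprime (2 ^ 2) (int p)"
      by (subst coprime_power_left_iff) simp
    then have cop: "coprime 4 (int p)" by simp
    have half: "\<nu> ((\<lambda>k. 4 * k + b) -` residue_class j p) = 1 / real p" for b
      using residue_class_affine_vimage[OF cop, of b j] unif prime_ge_1_nat[OF p] by metis
    show ?thesis
      unfolding \<mu>_def half by simp
  qed
  then have "\<mu> \<in> PR_probs"
    using fin_add_prob_mixture_vimage[OF \<nu>] by (simp add: PR_probs_def \<mu>_def)
  moreover have "\<mu> \<notin> R_probs"
  proof
    assume "\<mu> \<in> R_probs"
    then have "\<mu> (residue_class 0 4) = 1 / 4"
      by (auto simp: R_probs_def)
    moreover have "(\<lambda>k. 4 * k + 0) -` residue_class 0 4 = UNIV"
      "(\<lambda>k. 4 * k + 1) -` residue_class 0 4 = {}"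
      by (auto simp: residue_class_def cong_def)
    ultimately show False
      using \<nu>_triv by (simp add: \<mu>_def)
  qed
  ultimately show "R_probs \<noteq> PR_probs" by blast
qed

end
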